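(* Let $\Phi\in\Psi$, let $\Omega\subset\mathbb{R}$ be a bounded Lebesgue measurable set contained in a compact interval $[a,b]$, let $S_n\subseteq C([a,b])$ be an $n$-dimensional linear space (its elements being regarded as functions on $\Omega$ by restriction), and let $f\in L^{\Phi}(\Omega)$. Let $P\in S_n$. Then $P\in\mu_{\Phi}(f/S_n)$ if and only if $$\int_{\{Q>0,\ f>P\}\cup\{Q<0,\ f<P\}} \varphi^{-}(|f-P|)\,|Q|\,dx-\int_{\{Q<0,\ f>P\}\cup\{Q>0,\ f<P\}} \varphi^{+}(|f-P|)\,|Q|\,dx\ \le\ \varphi^{+}(0)\int_{\{f=P\}}|Q|\,dx$$ for every $Q\in S_n$.
   Context: All functions are real-valued and measure is Lebesgue measure. $\Im$ is the class of all non-decreasing functions $\varphi$ defined for all real $t\ge 0$ with $\varphi(t)>0$ for $t>0$. $\Psi$ is the class of all convex functions $\Phi(x)=\int_0^x\varphi(t)\,dt$, $x\ge 0$, with $\varphi\in\Im$; it is assumed throughout that $\Phi$ satisfies the $\Delta_2$ condition: there is a constant $\Lambda>0$ with $\Phi(2x)\le\Lambda\Phi(x)$ for all $x\ge0$. $\varphi^-$ and $\varphi^+$ denote the left and right derivatives of $\Phi$, respectively. $L^\Phi(\Omega)$ is the class of measurable functions $f$ on $\Omega$ with $\int_\Omega\Phi(|f|)\,dx<\infty$. For $S\subset L^\Phi(\Omega)$ and $f\in L^\Phi(\Omega)$, $\mu_\Phi(f/S)$ is the set of all best $\Phi$-approximations of $f$ from $S$, i.e. all $P\in S$ with $\int_\Omega\Phi(|f-P|)\,dx=\inf_{Q\in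 S}\int_\Omega\Phi(|f-Q|)\,dx$. Sets such as $\{Q>0,\ f>P\}$ denote $\{x\in\Omega: Q(x)>0,\ f(x)>P(x)\}$. *)

theory Defs
  imports "HOL-Analysis.Analysis" "HOL-Library.Function_Algebras"
begin

definition class_Im :: "(real \<Rightarrow> real) set" where
  "class_Im = {\<phi>. mono_on {0..} \<phi> \<and> (\<forall>t>0. \<phi> t > 0)}"

text \<open>Functions on \<open>[0, \<infinity>)\<close> are total functions of which only the values on \<open>{0..}\<close> matter.\<close>

definition class_Psi :: "(real \<Rightarrow> real) set" where
  "class_Psi = {\<Phi>. convex_on {0..} \<Phi> \<and>
     (\<exists>\<phi>\<in>class_Im. \<forall>x\<ge>0. \<Phi> x = (LINT t:{0..x}|lebesgue. \<phi> t))}"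

definition Delta2 :: "(real \<Rightarrow> real) \<Rightarrow> bool" where
  "Delta2 \<Phi> \<longleftrightarrow> (\<exists>\<Lambda>>0. \<forall>x\<ge>0. \<Phi> (2 * x) \<le> \<Lambda> * \<Phi> x)"

definition left_deriv :: "(real \<Rightarrow> real) \<Rightarrow> real \<Rightarrow> real" where
  "left_deriv F x = vector_derivative F (at_left x)"

definition right_deriv :: "(real \<Rightarrow> real) \<Rightarrow> real \<Rightarrow> real" where
  "right_deriv F x = vector_derivative F (at_right x)"

definition L_Phi :: "(real \<Rightarrow> real) \<Rightarrow> real set \<Rightarrow> (real \<Rightarrow> real) set" where
  "L_Phi \<Phi> \<Omega> = {f \<in> borel_measurable (lebesgue_on \<Omega>).
     integrable (lebesgue_on \<Omega>) (\<lambda>x. \<Phi> \<bar>f x\<bar>)}"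

definition best_approx ::
  "(real \<Rightarrow> real) \<Rightarrow> real set \<Rightarrow> (real \<Rightarrow> real) \<Rightarrow> (real \<Rightarrow> real) set \<Rightarrow> (real \<Rightarrow> real) set" where
  "best_approx \<Phi> \<Omega> f S = {P \<in> S.
     (LINT x|lebesgue_on \<Omega>. \<Phi> \<bar>f x - P x\<bar>) =
     (INF Q\<in>S. (LINT x|lebesgue_on \<Omega>. \<Phi> \<bar>f x - Q x\<bar>))}"

text \<open>A continuous function on \<open>[a, b]\<close> is represented by its extension by zero. The representation
  is bijective and linear, so the dimension of a space of such functions is its dimension as a
  subspace of \<open>C([a, b])\<close>.\<close>

definition cont_space :: "real \<Rightarrow> real \<Rightarrow> (real \<Rightarrow> real) set" where
  "cont_space a b = {g. continuous_on {a..b} g \<and> (\<forall>x. x \<notin> {a..b} \<longrightarrow> g x = 0)}"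

definition fun_scale :: "real \<Rightarrow> (real \<Rightarrow> real) \<Rightarrow> real \<Rightarrow> real" where
  "fun_scale c g = (\<lambda>x. c * g x)"

global_interpretation fn: vector_space fun_scale
  by unfold_locales (auto simp: fun_scale_def fun_eq_iff algebra_simps)

text \<open>An explicit finite basis is used because \<open>fn.dim\<close> is \<open>0\<close> on infinite-dimensional spaces.\<close>

definition has_dimension :: "(real \<Rightarrow> real) set \<Rightarrow> nat \<Rightarrow> bool" where
  "has_dimension S n \<longleftrightarrow>
     (\<exists>B. finite B \<and> card B = n \<and> \<not> fn.dependent B \<and> fn.span B = S)"

end

theory Submission
  imports Defs
begin

text \<open>The idea is that of a directional derivative. Write \<open>F t\<close> for the integral of
  \<open>\<Phi> \<bar>f - P - t * Q\<bar>\<close> over \<open>\<Omega>\<close>. Since \<open>S\<close> is a linear space, \<open>P\<close> is a best approximation iff for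
  every \<open>Q \<in> S\<close> the function \<open>F\<close> is minimal at \<open>0\<close> on the half-line \<open>t \<ge> 0\<close>
  (\<open>minimal_on_subspace_iff_on_rays\<close>). The function \<open>\<Phi> \<bar>y\<bar>\<close> is convex on the whole line, hence so is
  \<open>F\<close>, and a convex function is minimal at \<open>0\<close> on that half-line iff its right derivative there is
  nonnegative.

  The right derivative of \<open>F\<close> at \<open>0\<close> is the integral of the right derivatives of the integrand
  (\<open>integral_convex_minimal_on_ray_iff\<close>): by convexity the difference quotients for steps
  \<open>t \<le> 1\<close> lie between those for the steps \<open>- 1\<close> and \<open>1\<close>, which dominate them, and these are integrable because
  the \<open>\<Delta>\<^sub>2\<close> condition makes \<open>\<Phi> \<bar>f - R\<bar>\<close> integrable for every bounded measurable \<open>R\<close>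
  (\<open>integrable_phi_translate\<close>).

  With \<open>d = f - P\<close>, moving along \<open>Q\<close> decreases \<open>\<bar>d\<bar>\<close> where \<open>d\<close> and \<open>Q\<close> have the same sign, at the rate
  \<open>- \<phi>\<^sup>- \<bar>d\<bar> * \<bar>Q\<bar>\<close> for \<open>\<Phi> \<bar>d\<bar>\<close>; it increases \<open>\<bar>d\<bar>\<close> where the signs differ, at the rate
  \<open>\<phi>\<^sup>+ \<bar>d\<bar> * \<bar>Q\<bar>\<close>; and it increases \<open>\<bar>d\<bar>\<close> from \<open>0\<close> where \<open>d = 0\<close>, at the rate \<open>\<phi>\<^sup>+ 0 * \<bar>Q\<bar>\<close>
  (\<open>has_right_derivative_phi_direction\<close>). Integrating these rates and requiring the result to be
  nonnegative is the stated inequality.\<close>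

section \<open>One-sided derivatives of convex functions\<close>

text \<open>The slope of a convex function from \<open>x\<close> to \<open>y\<close> increases with \<open>y\<close> and, for \<open>y > x\<close>, is bounded below
  by the slope on the left of \<open>x\<close>. So it converges to its infimum as \<open>y\<close> decreases to \<open>x\<close>.\<close>

lemma convex_has_right_derivative:
  fixes g :: "real \<Rightarrow> real"
  assumes g: "convex_on UNIV g"
  shows "\<exists>l. (g has_real_derivative l) (at_right x)"
proof -
  define s where "s y = (g y - g x) / (y - x)" for y
  define l where "l = Inf (s ` {x<..})"
  have s_eq: "s y = (g x - g y) / (x - y)" for y
    unfolding s_def by (metis minus_diff_eq minus_divide_divide)
  have mono: "s y \<le> s z" if "x < y" "y < z" for y z
    unfolding s_eq by (rule convex_on_slope_le(1)[OF g _ _ that]) auto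
  have lower: "s (x - 1) \<le> s y" if "x < y" for y
  proof -
    have "(g (x - 1) - g x) / ((x - 1) - x) \<le> (g x - g y) / (x - y)"
      using that by (intro order_trans[OF convex_on_slope_le(1,2)[OF g, of "x - 1" y x]]) auto
    then show ?thesis unfolding s_eq[of y] s_def[of "x - 1"] .
  qed
  have bdd: "bdd_below (s ` {x<..})"
    by (rule bdd_belowI2[of _ "s (x - 1)"]) (simp add: lower)
  have "(s \<longlongrightarrow> l) (at_right x)"
  proof (rule order_tendstoI)
    fix a assume "a < l"
    have "l \<le> s y" if "x < y" for y
      unfolding l_def by (rule cInf_lower[OF _ bdd]) (simp add: that)
    then have "a < s y" if "x < y" for y
      using less_le_trans[OF \<open>a < l\<close>] that by blast
    then show "\<forall>\<^sub>F y in at_right x. a < s y"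
      using eventually_at_right_less[of x] by (rule_tac eventually_mono)
  next
    fix a assume "l < a"
    then obtain z where z: "x < z" "s z < a"
      using cInf_lessD[of "s ` {x<..}" a] unfolding l_def by auto
    have "\<forall>\<^sub>F y in at_right x. y \<in> {x<..<z}"
      by (rule eventually_at_right_real[OF z(1)])
    then show "\<forall>\<^sub>F y in at_right x. s y < a"
    proof eventually_elim
      case (elim y)
      then have "s y \<le> s z" by (intro mono) auto
      then show ?case using z(2) by (rule le_less_trans)
    qed
  qed
  then have "(g has_real_derivative l) (at_right x)"
    by (simp add: has_field_derivative_iff s_def[abs_def])
  then show ?thesis ..
qed

text \<open>The right derivative is the limit of slopes that are at most the slope up to \<open>z\<close>.\<close>

lemma convex_above_right_tangent:
  fixes g :: "real \<Rightarrow> real"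
  assumes g: "convex_on UNIV g" and l: "(g has_real_derivative l) (at_right x)" and "x < z"
  shows "l * (z - x) \<le> g z - g x"
proof -
  have "l \<le> (g z - g x) / (z - x)"
  proof (rule tendsto_upperbound)
    show "((\<lambda>y. (g y - g x) / (y - x)) \<longlongrightarrow> l) (at_right x)"
      using l by (simp add: has_field_derivative_iff)
    have "\<forall>\<^sub>F y in at_right x. y \<in> {x<..<z}"
      by (rule eventually_at_right_real[OF \<open>x < z\<close>])
    then show "\<forall>\<^sub>F y in at_right x. (g y - g x) / (y - x) \<le> (g z - g x) / (z - x)"
    proof eventually_elim
      case (elim y)
      then show ?case
        using convex_on_slope_le(1)[OF g, of x z y] by (metis UNIV_I greaterThanLessThan_iff
            minus_diff_eq minus_divide_divide)
    qed
  qed simp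
  then show ?thesis using \<open>x < z\<close> by (simp add: field_simps)
qed

lemma has_left_derivative_of_even:
  fixes g :: "real \<Rightarrow> real"
  assumes even: "\<And>y. g (- y) = g y" and l: "(g has_real_derivative l) (at_right (- x))"
  shows "(g has_real_derivative - l) (at_left x)"
proof -
  have "uminus ` {..<x} = {- x<..}" by (simp add: image_uminus_lessThan)
  then have "(g \<circ> uminus has_real_derivative l * - 1) (at_left x)"
    using l by (intro DERIV_image_chain) (auto intro!: derivative_eq_intros)
  moreover have "g \<circ> uminus = g" using even by (simp add: fun_eq_iff)
  ultimately show ?thesis by simp
qed

lemma has_right_derivative_of_even:
  fixes g :: "real \<Rightarrow> real"
  assumes even: "\<And>y. g (- y) = g y" and l: "(g has_real_derivative l) (at_left (- x))"
  shows "(g has_real_derivative - l) (at_right x)"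
proof -
  have "uminus ` {x<..} = {..<- x}" by (simp add: image_uminus_greaterThan)
  then have "(g \<circ> uminus has_real_derivative l * - 1) (at_right x)"
    using l by (intro DERIV_image_chain) (auto intro!: derivative_eq_intros)
  moreover have "g \<circ> uminus = g" using even by (simp add: fun_eq_iff)
  ultimately show ?thesis by simp
qed

text \<open>A motion with velocity \<open>q\<close> starting at \<open>d\<close> only sees the values of \<open>g\<close> on the side of \<open>d\<close> given by the
  sign of \<open>q\<close>, so only the derivative from that side matters.\<close>

lemma has_right_derivative_along_line:
  fixes g :: "real \<Rightarrow> real"
  assumes l: "0 < q \<Longrightarrow> (g has_real_derivative l) (at_right d)"
    and r: "q < 0 \<Longrightarrow> (g has_real_derivative l) (at_left d)"
    and "q \<noteq> 0"
  shows "((\<lambda>t. g (d + t * q)) has_real_derivative l * q) (at_right 0)"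
proof -
  have *: "((\<lambda>t. d + t * q) has_real_derivative q) (at_right 0)"
    by (auto intro!: derivative_eq_intros)
  have img: "(\<lambda>t. d + t * q) ` {0<..} \<subseteq> (if q > 0 then {d<..} else {..<d})"
    using \<open>q \<noteq> 0\<close> by (auto simp: mult_less_0_iff zero_less_mult_iff)
  have "(g has_real_derivative l) (at d within (\<lambda>t. d + t * q) ` {0<..})"
    using l r \<open>q \<noteq> 0\<close> img by (cases "q > 0") (auto elim: DERIV_subset)
  then have "(g \<circ> (\<lambda>t. d + t * q) has_real_derivative l * q) (at_right 0)"
    using * by (intro DERIV_image_chain) auto
  then show ?thesis by (simp add: o_def)
qed

lemma convex_on_along_line:
  fixes g :: "real \<Rightarrow> real"
  assumes "convex_on UNIV g"
  shows "convex_on UNIV (\<lambda>t. g (d + t * q))"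
proof
  fix t x y :: real assume "0 < t" "t < 1"
  have "d + ((1 - t) *\<^sub>R x + t *\<^sub>R y) * q = (1 - t) *\<^sub>R (d + x * q) + t *\<^sub>R (d + y * q)"
    by (simp add: algebra_simps)
  then show "g (d + ((1 - t) *\<^sub>R x + t *\<^sub>R y) * q) \<le> (1 - t) * g (d + x * q) + t * g (d + y * q)"
    using convex_onD[OF assms, of t "d + x * q" "d + y * q"] \<open>0 < t\<close> \<open>t < 1\<close> by simp
qed simp

section \<open>Minimality along a ray for an integral of convex functions\<close>

text \<open>If the integral is minimal at \<open>0\<close>, its difference quotients are nonnegative, and by dominated
  convergence they tend to the integral of \<open>k\<close>. Conversely every \<open>h x\<close> lies above its right tangent at
  \<open>0\<close>, and integrating this bound gives minimality.\<close>

lemma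
  fixes h :: "'a \<Rightarrow> real \<Rightarrow> real" and k :: "'a \<Rightarrow> real"
  assumes conv: "\<And>x. x \<in> space M \<Longrightarrow> convex_on UNIV (h x)"
    and int: "\<And>t. integrable M (\<lambda>x. h x t)"
    and der: "\<And>x. x \<in> space M \<Longrightarrow> (h x has_real_derivative k x) (at_right 0)"
  shows integrable_right_derivative: "integrable M k"
    and integral_convex_minimal_on_ray_iff:
      "(\<forall>t>0. (LINT x|M. h x 0) \<le> (LINT x|M. h x t)) \<longleftrightarrow> 0 \<le> (LINT x|M. k x)"
proof -
  \<comment> \<open>Dominated convergence needs sequences, so the step runs through \<open>1, 1/2, 1/3, \<dots>\<close>. All these
    steps are at most \<open>1\<close>, as required for comparing the slopes with those for the steps \<open>1\<close> and \<open>- 1\<close>.\<close>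
  define \<tau> where "\<tau> n = inverse (real (Suc n))" for n
  have \<tau>: "0 < \<tau> n" "\<tau> n \<le> 1" for n by (auto simp: \<tau>_def field_simps)
  have \<tau>_lim: "filterlim \<tau> (at_right 0) sequentially"
  proof -
    have "\<tau> \<longlonglongrightarrow> 0" unfolding \<tau>_def by (rule LIMSEQ_inverse_real_of_nat)
    moreover have "\<tau> n \<noteq> 0" for n using \<tau>(1)[of n] by simp
    ultimately show ?thesis using \<tau>(1) by (simp add: filterlim_at)
  qed
  define s where "s n x = (h x (\<tau> n) - h x 0) / \<tau> n" for n x
  define w where "w x = \<bar>h x 1 - h x 0\<bar> + \<bar>h x 0 - h x (- 1)\<bar>" for x
  have s_int: "integrable M (s n)" for n
    unfolding s_def using int by auto
  have w_int: "integrable M w"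
    unfolding w_def using int by auto
  have lim: "(\<lambda>n. s n x) \<longlonglongrightarrow> k x" if "x \<in> space M" for x
  proof -
    have "((\<lambda>t. (h x t - h x 0) / t) \<longlongrightarrow> k x) (at_right 0)"
      using der[OF that] by (simp add: has_field_derivative_iff)
    from filterlim_compose[OF this \<tau>_lim] show ?thesis by (simp add: s_def)
  qed
  have k_meas: "k \<in> borel_measurable M"
    by (rule borel_measurable_LIMSEQ_real[OF lim borel_measurable_integrable[OF s_int]])
  have bound: "norm (s n x) \<le> w x" if x: "x \<in> space M" for n x
  proof -
    have slope: "(h x 0 - h x (\<tau> n)) / (0 - \<tau> n) = s n x"
      using \<tau>(1)[of n] by (simp add: s_def field_simps)
    have up: "s n x \<le> h x 1 - h x 0"
    proof (cases "\<tau> n = 1")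
      case False
      then have "(h x 0 - h x (\<tau> n)) / (0 - \<tau> n) \<le> (h x 0 - h x 1) / (0 - 1)"
        using \<tau>[of n] by (intro convex_on_slope_le[OF conv[OF x]]) auto
      then show ?thesis unfolding slope by simp
    qed (simp add: s_def)
    have lo1: "(h x (- 1) - h x (\<tau> n)) / (- 1 - \<tau> n) \<le> (h x 0 - h x (\<tau> n)) / (0 - \<tau> n)"
      and lo2: "(h x (- 1) - h x 0) / (- 1 - 0) \<le> (h x (- 1) - h x (\<tau> n)) / (- 1 - \<tau> n)"
      using \<tau>[of n] by (intro convex_on_slope_le[OF conv[OF x]]; simp)+
    have "h x 0 - h x (- 1) \<le> s n x" using order_trans[OF lo2 lo1] unfolding slope by simp
    with up show ?thesis by (simp add: w_def)
  qed
  show k_int: "integrable M k"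
    by (rule integrable_dominated_convergence[of k M s w])
       (simp_all add: k_meas w_int borel_measurable_integrable[OF s_int] lim bound del: real_norm_def)
  have int_lim: "(\<lambda>n. integral\<^sup>L M (s n)) \<longlonglongrightarrow> integral\<^sup>L M k"
    by (rule integral_dominated_convergence[of k M s w])
       (simp_all add: k_meas w_int borel_measurable_integrable[OF s_int] lim bound del: real_norm_def)
  show "(\<forall>t>0. (LINT x|M. h x 0) \<le> (LINT x|M. h x t)) \<longleftrightarrow> 0 \<le> (LINT x|M. k x)"
  proof
    assume min: "\<forall>t>0. (LINT x|M. h x 0) \<le> (LINT x|M. h x t)"
    have "0 \<le> integral\<^sup>L M (s n)" for n
    proof -
      have "integral\<^sup>L M (s n) = ((LINT x|M. h x (\<tau> n)) - (LINT x|M. h x 0)) / \<tau> n"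
        unfolding s_def using int by simp
      then show ?thesis using min \<tau>[of n] by simp
    qed
    with int_lim show "0 \<le> (LINT x|M. k x)" by (auto intro: LIMSEQ_le_const)
  next
    assume nonneg: "0 \<le> (LINT x|M. k x)"
    show "\<forall>t>0. (LINT x|M. h x 0) \<le> (LINT x|M. h x t)"
    proof (intro allI impI)
      fix t :: real assume "0 < t"
      have "0 \<le> (LINT x|M. k x * t)" using nonneg \<open>0 < t\<close> by simp
      also have "\<dots> \<le> (LINT x|M. h x t - h x 0)"
        using k_int int convex_above_right_tangent[OF conv der \<open>0 < t\<close>]
        by (intro integral_mono) auto
      finally show "(LINT x|M. h x 0) \<le> (LINT x|M. h x t)" using int by simp
    qed
  qed
qed

section \<open>The functions of the class\<close>

lemma class_Psi_zero_nonneg: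
  assumes "\<Phi> \<in> class_Psi"
  shows "\<Phi> 0 = 0" and "\<And>x. 0 \<le> x \<Longrightarrow> 0 \<le> \<Phi> x"
proof -
  obtain \<phi> where pos: "\<And>t. t > 0 \<Longrightarrow> \<phi> t > 0"
    and \<Phi>: "\<And>x. x \<ge> 0 \<Longrightarrow> \<Phi> x = (LINT t:{0..x}|lebesgue. \<phi> t)"
    using assms by (auto simp: class_Psi_def class_Im_def)
  \<comment> \<open>The density \<open>\<phi>\<close> may be negative at the single point \<open>0\<close>, which is a null set.\<close>
  have AE0: "AE t in lebesgue. t \<noteq> (0::real)"
    by (rule AE_I[of _ _ "{0}"]) auto
  have "(LINT t:{0..0}|lebesgue. \<phi> t) = 0"
    unfolding set_lebesgue_integral_def
    by (rule integral_eq_zero_AE) (use AE0 in eventually_elim, auto simp: indicator_def)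
  then show "\<Phi> 0 = 0" using \<Phi>[of 0] by simp
  fix x :: real assume "0 \<le> x"
  have "0 \<le> (LINT t:{0..x}|lebesgue. \<phi> t)"
    unfolding set_lebesgue_integral_def
  proof (rule integral_nonneg_AE)
    show "AE t in lebesgue. 0 \<le> indicator {0..x} t *\<^sub>R \<phi> t"
      using AE0 by eventually_elim (auto simp: indicator_def intro: less_imp_le[OF pos])
  qed
  then show "0 \<le> \<Phi> x" using \<Phi>[OF \<open>0 \<le> x\<close>] by simp
qed

text \<open>This follows from convexity alone once \<open>\<Phi> 0 = 0 \<le> \<Phi> y\<close> is known, because \<open>x\<close> lies between
  \<open>0\<close> and \<open>y\<close>.\<close>

lemma class_Psi_mono:
  assumes "\<Phi> \<in> class_Psi" and "0 \<le> x" "x \<le> y"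
  shows "\<Phi> x \<le> \<Phi> y"
proof (cases "y = 0")
  case False
  have conv: "convex_on {0..} \<Phi>" using assms by (simp add: class_Psi_def)
  define t where "t = x / y"
  have t: "0 \<le> t" "t \<le> 1" "x = (1 - t) *\<^sub>R 0 + t *\<^sub>R y" 
    using assms False by (auto simp: t_def)
  have "\<Phi> x \<le> (1 - t) * \<Phi> 0 + t * \<Phi> y"
    unfolding t(3) using assms t(1,2) by (intro convex_onD[OF conv]) auto
  also have "\<dots> \<le> \<Phi> y"
    using t assms class_Psi_zero_nonneg[OF assms(1)] by (simp add: mult_left_le_one_le)
  finally show ?thesis .
qed (use assms in simp)

text \<open>Passing to \<open>\<Phi> \<bar>y\<bar>\<close> removes the boundary point \<open>0\<close> of the domain of \<open>\<Phi>\<close>: the theory of convex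
  functions on the whole line applies, and \<open>0\<close> becomes an interior point, where
  both one-sided derivatives exist.\<close>

lemma class_Psi_convex_abs:
  assumes "\<Phi> \<in> class_Psi"
  shows "convex_on UNIV (\<lambda>x. \<Phi> \<bar>x\<bar>)"
proof
  have conv: "convex_on {0..} \<Phi>" using assms by (simp add: class_Psi_def)
  fix t x y :: real assume t: "0 < t" "t < 1"
  have "\<bar>(1 - t) *\<^sub>R x + t *\<^sub>R y\<bar> \<le> (1 - t) *\<^sub>R \<bar>x\<bar> + t *\<^sub>R \<bar>y\<bar>"
    using t abs_triangle_ineq[of "(1 - t) * x" "t * y"] by (simp add: abs_mult)
  then have "\<Phi> \<bar>(1 - t) *\<^sub>R x + t *\<^sub>R y\<bar> \<le> \<Phi> ((1 - t) *\<^sub>R \<bar>x\<bar> + t *\<^sub>R \<bar>y\<bar>)"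
    by (intro class_Psi_mono[OF assms]) auto
  also have "\<dots> \<le> (1 - t) * \<Phi> \<bar>x\<bar> + t * \<Phi> \<bar>y\<bar>"
    using t by (intro convex_onD[OF conv]) auto
  finally show "\<Phi> \<bar>(1 - t) *\<^sub>R x + t *\<^sub>R y\<bar> \<le> (1 - t) * \<Phi> \<bar>x\<bar> + t * \<Phi> \<bar>y\<bar>" .
qed simp

text \<open>The existence of the limit comes from the convexity of \<open>\<Phi> \<bar>y\<bar>\<close>; its value is that for \<open>\<Phi>\<close>,
  since both functions agree on the right of \<open>x \<ge> 0\<close>.\<close>

lemma class_Psi_right_deriv:
  assumes "\<Phi> \<in> class_Psi" and "0 \<le> x"
  shows "((\<lambda>y. \<Phi> \<bar>y\<bar>) has_real_derivative right_deriv \<Phi> x) (at_right x)"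
proof -
  obtain l where l: "((\<lambda>y. \<Phi> \<bar>y\<bar>) has_real_derivative l) (at_right x)"
    using convex_has_right_derivative[OF class_Psi_convex_abs[OF assms(1)]] by blast
  then have "((\<lambda>y. \<Phi> \<bar>y\<bar>) has_real_derivative l) (at x within {x<..})" by simp
  then have "(\<Phi> has_real_derivative l) (at_right x)"
    using \<open>0 \<le> x\<close> unfolding has_field_derivative_iff
    by (rule_tac Lim_transform_eventually) (auto simp: eventually_at_filter)
  then have "right_deriv \<Phi> x = l"
    unfolding right_deriv_def
    by (intro vector_derivative_within) (auto simp: has_real_derivative_iff_has_vector_derivative)
  with l show ?thesis by simp
qed

lemma class_Psi_left_deriv:
  assumes "\<Phi> \<in> class_Psi" and "0 < x"
  shows "((\<lambda>y. \<Phi> \<bar>y\<bar>) has_real_derivative left_deriv \<Phi> x) (at_left x)"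
proof -
  obtain r where "((\<lambda>y. \<Phi> \<bar>y\<bar>) has_real_derivative r) (at_right (- x))"
    using convex_has_right_derivative[OF class_Psi_convex_abs[OF assms(1)]] by blast
  then have l: "((\<lambda>y. \<Phi> \<bar>y\<bar>) has_real_derivative - r) (at_left x)"
    by (intro has_left_derivative_of_even) auto
  have "\<forall>\<^sub>F y in at_left x. y \<in> {0<..<x}"
    using \<open>0 < x\<close> by (rule eventually_at_left_real)
  then have "\<forall>\<^sub>F y in at_left x. (\<Phi> \<bar>y\<bar> - \<Phi> \<bar>x\<bar>) / (y - x) = (\<Phi> y - \<Phi> x) / (y - x)"
    by eventually_elim (use \<open>0 < x\<close> in auto)
  with l have "(\<Phi> has_real_derivative - r) (at_left x)"
    unfolding has_field_derivative_iff by (rule Lim_transform_eventually)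
  then have "left_deriv \<Phi> x = - r"
    unfolding left_deriv_def
    by (intro vector_derivative_within) (auto simp: has_real_derivative_iff_has_vector_derivative)
  with l show ?thesis by simp
qed

text \<open>The rate at which \<open>\<Phi> \<bar>d - t * q\<bar>\<close> starts to change as \<open>t\<close> grows from \<open>0\<close>. The sign of the product
  \<open>d * q\<close> tells whether \<open>d\<close> moves towards \<open>0\<close> or away from it.\<close>

definition phi_direction :: "(real \<Rightarrow> real) \<Rightarrow> real \<Rightarrow> real \<Rightarrow> real" where
  "phi_direction \<Phi> d q =
    (if 0 < d * q then - (left_deriv \<Phi> \<bar>d\<bar> * \<bar>q\<bar>)
     else if d * q < 0 then right_deriv \<Phi> \<bar>d\<bar> * \<bar>q\<bar>
     else if d = 0 then right_deriv \<Phi> 0 * \<bar>q\<bar> else 0)"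

lemma has_right_derivative_phi_direction:
  assumes \<Phi>: "\<Phi> \<in> class_Psi"
  shows "((\<lambda>t. \<Phi> \<bar>d - t * q\<bar>) has_real_derivative phi_direction \<Phi> d q) (at_right 0)"
proof (cases "q = 0")
  case True
  then show ?thesis by (simp add: phi_direction_def)
next
  case False
  let ?G = "\<lambda>y. \<Phi> \<bar>y\<bar>"
  \<comment> \<open>The point \<open>d - t * q\<close> leaves \<open>d\<close> to the left if \<open>q > 0\<close> and to the right if \<open>q < 0\<close>, so \<open>l\<close> is the left
    or the right derivative of the even function \<open>?G\<close> at \<open>d\<close>; for negative \<open>d\<close> reflection at \<open>0\<close>
    exchanges the two and changes the sign.\<close>
  define l where "l = (if d > 0 then (if q > 0 then left_deriv \<Phi> d else right_deriv \<Phi> d)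
     else if d < 0 then (if q > 0 then - right_deriv \<Phi> (- d) else - left_deriv \<Phi> (- d))
     else (if q > 0 then - right_deriv \<Phi> 0 else right_deriv \<Phi> 0))"
  have left: "(?G has_real_derivative l) (at_left d)" if "q > 0"
    using that class_Psi_left_deriv[OF \<Phi>, of d]
      has_left_derivative_of_even[of ?G "right_deriv \<Phi> (- d)" d]
      class_Psi_right_deriv[OF \<Phi>, of "- d"]
    by (cases "d > 0"; cases "d = 0") (auto simp: l_def)
  have right: "(?G has_real_derivative l) (at_right d)" if "q < 0"
    using that class_Psi_right_deriv[OF \<Phi>, of d]
      has_right_derivative_of_even[of ?G "left_deriv \<Phi> (- d)" d]
      class_Psi_left_deriv[OF \<Phi>, of "- d"]
    by (cases "d > 0"; cases "d = 0") (auto simp: l_def)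
  have "((\<lambda>t. ?G (d + t * (- q))) has_real_derivative l * (- q)) (at_right 0)"
    using left right False by (intro has_right_derivative_along_line) auto
  moreover have "l * (- q) = phi_direction \<Phi> d q"
    using False by (auto simp: l_def phi_direction_def zero_less_mult_iff mult_less_0_iff)
  ultimately show ?thesis by simp
qed

section \<open>Best approximation\<close>

text \<open>Since \<open>\<bar>f - g\<bar>\<close> is at most the midpoint of \<open>2 * \<bar>f\<bar>\<close> and \<open>2 * C\<close>, convexity and the \<open>\<Delta>\<^sub>2\<close> condition
  bound \<open>\<Phi> \<bar>f - g\<bar>\<close> by \<open>\<Lambda> / 2\<close> times \<open>\<Phi> \<bar>f\<bar> + \<Phi> \<bar>C\<bar>\<close>.\<close>

lemma integrable_phi_translate:
  assumes \<Phi>: "\<Phi> \<in> class_Psi" "Delta2 \<Phi>"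
    and M: "finite_measure M"
    and f: "f \<in> borel_measurable M" "integrable M (\<lambda>x. \<Phi> \<bar>f x\<bar>)"
    and g: "g \<in> borel_measurable M" "\<And>x. x \<in> space M \<Longrightarrow> \<bar>g x\<bar> \<le> C"
  shows "integrable M (\<lambda>x. \<Phi> \<bar>f x - g x :: real\<bar>)"
proof -
  interpret finite_measure M by fact
  obtain \<Lambda> where \<Lambda>: "\<And>x. 0 \<le> x \<Longrightarrow> \<Phi> (2 * x) \<le> \<Lambda> * \<Phi> x"
    using \<Phi>(2) by (auto simp: Delta2_def)
  have conv: "convex_on UNIV (\<lambda>x. \<Phi> \<bar>x\<bar>)" by (rule class_Psi_convex_abs[OF \<Phi>(1)])
  show ?thesis
  proof (rule Bochner_Integration.integrable_bound)
    show "integrable M (\<lambda>x. (\<Lambda> / 2) * \<Phi> \<bar>f x\<bar> + (\<Lambda> / 2) * \<Phi> \<bar>C\<bar>)"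
      using f(2) by auto
    show "(\<lambda>x. \<Phi> \<bar>f x - g x\<bar>) \<in> borel_measurable M"
      using convex_measurable[OF _ _ _ conv, of "\<lambda>x. f x - g x" M] f(1) g(1) by auto
    show "AE x in M. norm (\<Phi> \<bar>f x - g x\<bar>) \<le> norm ((\<Lambda> / 2) * \<Phi> \<bar>f x\<bar> + (\<Lambda> / 2) * \<Phi> \<bar>C\<bar>)"
    proof (rule AE_I2)
      fix x assume x: "x \<in> space M"
      have "\<Phi> \<bar>f x - g x\<bar> \<le> \<Phi> \<bar>(1 - 1/2) *\<^sub>R (2 * \<bar>f x\<bar>) + (1/2) *\<^sub>R (2 * \<bar>C\<bar>)\<bar>"
        using g(2)[OF x] by (intro class_Psi_mono[OF \<Phi>(1)]) auto
      also have "\<dots> \<le> (1 - 1/2) * \<Phi> \<bar>2 * \<bar>f x\<bar>\<bar> + (1/2) * \<Phi> \<bar>2 * \<bar>C\<bar>\<bar>"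
        by (rule convex_onD[OF conv]) auto
      also have "\<dots> \<le> (\<Lambda> / 2) * \<Phi> \<bar>f x\<bar> + (\<Lambda> / 2) * \<Phi> \<bar>C\<bar>"
        using \<Lambda>[of "\<bar>f x\<bar>"] \<Lambda>[of "\<bar>C\<bar>"] by (simp add: abs_mult)
      finally have "\<Phi> \<bar>f x - g x\<bar> \<le> (\<Lambda> / 2) * \<Phi> \<bar>f x\<bar> + (\<Lambda> / 2) * \<Phi> \<bar>C\<bar>" .
      then show "norm (\<Phi> \<bar>f x - g x\<bar>) \<le> norm ((\<Lambda> / 2) * \<Phi> \<bar>f x\<bar> + (\<Lambda> / 2) * \<Phi> \<bar>C\<bar>)"
        using class_Psi_zero_nonneg(2)[OF \<Phi>(1), of "\<bar>f x - g x\<bar>"] by simp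
    qed
  qed
qed

lemma cont_space_bounded_measurable:
  assumes "g \<in> cont_space a b" and \<Omega>: "\<Omega> \<in> sets lebesgue" "\<Omega> \<subseteq> {a..b}"
  shows "g \<in> borel_measurable (lebesgue_on \<Omega>)" and "\<exists>C. \<forall>x. \<bar>g x\<bar> \<le> C"
proof -
  have cont: "continuous_on {a..b} g" and zero: "\<And>x. x \<notin> {a..b} \<Longrightarrow> g x = 0"
    using assms(1) by (auto simp: cont_space_def)
  show "g \<in> borel_measurable (lebesgue_on \<Omega>)"
    using continuous_on_subset[OF cont \<Omega>(2)] \<Omega>(1)
    by (rule continuous_imp_measurable_on_sets_lebesgue)
  have "bounded (g ` {a..b})"
    using cont by (intro compact_imp_bounded compact_continuous_image) auto
  then obtain C where C: "\<forall>x\<in>{a..b}. \<bar>g x\<bar> \<le> C"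
    unfolding bounded_iff by (metis imageI real_norm_def)
  have "\<bar>g x\<bar> \<le> \<bar>C\<bar>" for x
    using bspec[OF C, of x] zero[of x] by (cases "x \<in> {a..b}") auto
  then show "\<exists>C. \<forall>x. \<bar>g x\<bar> \<le> C" by blast
qed

text \<open>The integrals are nonnegative, so their infimum over \<open>S\<close> is a genuine greatest lower bound.\<close>

lemma best_approx_iff_minimal:
  assumes \<Phi>: "\<Phi> \<in> class_Psi" and "P \<in> S"
  shows "P \<in> best_approx \<Phi> \<Omega> f S \<longleftrightarrow>
    (\<forall>R\<in>S. (LINT x|lebesgue_on \<Omega>. \<Phi> \<bar>f x - P x\<bar>) \<le> (LINT x|lebesgue_on \<Omega>. \<Phi> \<bar>f x - R x\<bar>))"
proof -
  let ?I = "\<lambda>R. LINT x|lebesgue_on \<Omega>. \<Phi> \<bar>f x - R x\<bar>"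
  have nonneg: "0 \<le> ?I R" for R
    using class_Psi_zero_nonneg(2)[OF \<Phi>] by (intro integral_nonneg_AE) auto
  then have bdd: "bdd_below (?I ` S)" by (auto intro!: bdd_belowI[of _ 0])
  have "?I P = (INF R\<in>S. ?I R) \<longleftrightarrow> (\<forall>R\<in>S. ?I P \<le> ?I R)"
  proof
    assume "?I P = (INF R\<in>S. ?I R)"
    then show "\<forall>R\<in>S. ?I P \<le> ?I R" using cINF_lower[OF bdd] by auto
  next
    assume "\<forall>R\<in>S. ?I P \<le> ?I R"
    then show "?I P = (INF R\<in>S. ?I R)"
      using \<open>P \<in> S\<close> by (intro antisym cINF_greatest cINF_lower[OF bdd]) auto
  qed
  with \<open>P \<in> S\<close> show ?thesis by (simp add: best_approx_def)
qed

text \<open>The element \<open>R\<close> of \<open>S\<close> is the point at \<open>t = 1\<close> on the ray from \<open>P\<close> in the direction \<open>R - P\<close>.\<close>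

lemma minimal_on_subspace_iff_on_rays:
  assumes S: "fn.subspace S" and "P \<in> S"
  shows "(\<forall>R\<in>S. I P \<le> (I R :: real)) \<longleftrightarrow> (\<forall>Q\<in>S. \<forall>t>0. I P \<le> I (\<lambda>x. P x + t * Q x))"
proof (intro iffI ballI allI impI)
  fix Q and t :: real
  assume min: "\<forall>R\<in>S. I P \<le> I R" and "Q \<in> S"
  have "P + fun_scale t Q \<in> S"
    using S \<open>P \<in> S\<close> \<open>Q \<in> S\<close> by (intro fn.subspace_add fn.subspace_scale)
  moreover have "P + fun_scale t Q = (\<lambda>x. P x + t * Q x)"
    by (simp add: fun_scale_def fun_eq_iff)
  ultimately show "I P \<le> I (\<lambda>x. P x + t * Q x)" using min by metis
next
  fix R assume ray: "\<forall>Q\<in>S. \<forall>t>0. I P \<le> I (\<lambda>x. P x + t * Q x)" and "R \<in> S"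
  have "R - P \<in> S" using S \<open>R \<in> S\<close> \<open>P \<in> S\<close> by (rule fn.subspace_diff)
  with ray have "I P \<le> I (\<lambda>x. P x + 1 * (R - P) x)" by (metis zero_less_one)
  moreover have "(\<lambda>x. P x + 1 * (R - P) x) = R" by (simp add: fun_eq_iff)
  ultimately show "I P \<le> I R" by simp
qed

lemma integral_lebesgue_on_subset:
  fixes g :: "real \<Rightarrow> real"
  assumes "\<Omega> \<in> sets lebesgue" "A \<subseteq> \<Omega>"
  shows "(LINT x|lebesgue_on \<Omega>. indicator A x * g x) = (LINT x:A|lebesgue. g x)"
proof -
  have "(\<lambda>x. indicator \<Omega> x *\<^sub>R (indicator A x * g x)) = (\<lambda>x. indicator A x *\<^sub>R g x)"
    using assms(2) by (auto simp: fun_eq_iff indicator_def)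
  then show ?thesis
    using assms(1) by (simp add: set_lebesgue_integral_def integral_restrict_space)
qed

text \<open>The integrability of the whole rate is assumed, and the three integrands inherit it by restriction:
  this allows the integral to be split.\<close>

lemma integral_phi_direction:
  fixes \<Phi> d Q :: "real \<Rightarrow> real"
  assumes \<Omega>: "\<Omega> \<in> sets lebesgue"
    and meas: "d \<in> borel_measurable (lebesgue_on \<Omega>)" "Q \<in> borel_measurable (lebesgue_on \<Omega>)"
    and int: "integrable (lebesgue_on \<Omega>) (\<lambda>x. phi_direction \<Phi> (d x) (Q x))"
  shows "(LINT x|lebesgue_on \<Omega>. phi_direction \<Phi> (d x) (Q x)) =
    right_deriv \<Phi> 0 * (LINT x:{x\<in>\<Omega>. d x = 0}|lebesgue. \<bar>Q x\<bar>)
    + (LINT x:{x\<in>\<Omega>. d x * Q x < 0}|lebesgue. right_deriv \<Phi> \<bar>d x\<bar> * \<bar>Q x\<bar>)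
    - (LINT x:{x\<in>\<Omega>. 0 < d x * Q x}|lebesgue. left_deriv \<Phi> \<bar>d x\<bar> * \<bar>Q x\<bar>)"
proof -
  let ?M = "lebesgue_on \<Omega>" and ?k = "\<lambda>x. phi_direction \<Phi> (d x) (Q x)"
  define A where "A = {x\<in>\<Omega>. 0 < d x * Q x}"
  define B where "B = {x\<in>\<Omega>. d x * Q x < 0}"
  define Z where "Z = {x\<in>\<Omega>. d x = 0}"
  have "{x \<in> space ?M. 0 < d x * Q x} \<in> sets ?M" "{x \<in> space ?M. d x * Q x < 0} \<in> sets ?M"
    "{x \<in> space ?M. d x = 0} \<in> sets ?M"
    using meas by (intro borel_measurable_less borel_measurable_eq; simp)+
  then have sets: "A \<in> sets ?M" "B \<in> sets ?M" "Z \<in> sets ?M"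
    by (simp_all add: A_def B_def Z_def)
  have piece: "integrable ?M (\<lambda>x. indicator E x * ?k x)" if "E \<in> sets ?M" for E
    using integrable_mult_indicator[OF that int] by simp
  have sub: "A \<subseteq> \<Omega>" "B \<subseteq> \<Omega>" "Z \<subseteq> \<Omega>" by (auto simp: A_def B_def Z_def)
  have "(LINT x|?M. ?k x) =
      (LINT x|?M. indicator Z x * ?k x + indicator B x * ?k x + indicator A x * ?k x)"
    by (rule Bochner_Integration.integral_cong)
       (auto simp: A_def B_def Z_def phi_direction_def indicator_def)
  also have "\<dots> = (LINT x|?M. indicator Z x * ?k x) + (LINT x|?M. indicator B x * ?k x)
      + (LINT x|?M. indicator A x * ?k x)"
    using sets piece by simp
  also have "(LINT x|?M. indicator Z x * ?k x)
      = (LINT x|?M. indicator Z x * (right_deriv \<Phi> 0 * \<bar>Q x\<bar>))"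
    by (rule Bochner_Integration.integral_cong)
       (auto simp: Z_def phi_direction_def indicator_def)
  also have "(LINT x|?M. indicator B x * ?k x)
      = (LINT x|?M. indicator B x * (right_deriv \<Phi> \<bar>d x\<bar> * \<bar>Q x\<bar>))"
    by (rule Bochner_Integration.integral_cong)
       (auto simp: B_def phi_direction_def indicator_def)
  also have "(LINT x|?M. indicator A x * ?k x)
      = (LINT x|?M. indicator A x * (- (left_deriv \<Phi> \<bar>d x\<bar> * \<bar>Q x\<bar>)))"
    by (rule Bochner_Integration.integral_cong)
       (auto simp: A_def phi_direction_def indicator_def)
  finally show ?thesis
    by (simp only: integral_lebesgue_on_subset[OF \<Omega>] sub)
       (simp add: A_def B_def Z_def set_lebesgue_integral_def mult.left_commute)
qed

theorem theorem2p1: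
  fixes \<Phi> f P :: "real \<Rightarrow> real" and \<Omega> :: "real set" and a b :: real
    and S :: "(real \<Rightarrow> real) set" and n :: nat
  assumes "\<Phi> \<in> class_Psi" and "Delta2 \<Phi>"
    and "a \<le> b" and "\<Omega> \<in> sets lebesgue" and "bounded \<Omega>" and "\<Omega> \<subseteq> {a..b}"
    and "S \<subseteq> cont_space a b" and "fn.subspace S" and "has_dimension S n"
    and "f \<in> L_Phi \<Phi> \<Omega>"
    and "P \<in> S"
  shows "P \<in> best_approx \<Phi> \<Omega> f S \<longleftrightarrow>
    (\<forall>Q\<in>S.
      (LINT x:{x\<in>\<Omega>. Q x > 0 \<and> f x > P x} \<union> {x\<in>\<Omega>. Q x < 0 \<and> f x < P x}|lebesgue.
         left_deriv \<Phi> \<bar>f x - P x\<bar> * \<bar>Q x\<bar>)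
      - (LINT x:{x\<in>\<Omega>. Q x < 0 \<and> f x > P x} \<union> {x\<in>\<Omega>. Q x > 0 \<and> f x < P x}|lebesgue.
         right_deriv \<Phi> \<bar>f x - P x\<bar> * \<bar>Q x\<bar>)
      \<le> right_deriv \<Phi> 0 * (LINT x:{x\<in>\<Omega>. f x = P x}|lebesgue. \<bar>Q x\<bar>))"
proof -
  let ?M = "lebesgue_on \<Omega>" and ?I = "\<lambda>R. LINT x|lebesgue_on \<Omega>. \<Phi> \<bar>f x - R x\<bar>"
  have f: "f \<in> borel_measurable ?M" "integrable ?M (\<lambda>x. \<Phi> \<bar>f x\<bar>)"
    using assms(10) by (auto simp: L_Phi_def)
  have fin: "finite_measure ?M"
    using assms(4,5) by (intro finite_measure_lebesgue_on bounded_set_imp_lmeasurable)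
  have meas: "R \<in> borel_measurable ?M" and bdd: "\<exists>C. \<forall>x. \<bar>R x\<bar> \<le> C" if "R \<in> S" for R
    using cont_space_bounded_measurable[OF _ assms(4,6)] assms(7) that by blast+
  have ray: "(\<forall>t>0. ?I P \<le> ?I (\<lambda>x. P x + t * Q x)) \<longleftrightarrow>
      (LINT x:{x\<in>\<Omega>. Q x > 0 \<and> f x > P x} \<union> {x\<in>\<Omega>. Q x < 0 \<and> f x < P x}|lebesgue.
         left_deriv \<Phi> \<bar>f x - P x\<bar> * \<bar>Q x\<bar>)
      - (LINT x:{x\<in>\<Omega>. Q x < 0 \<and> f x > P x} \<union> {x\<in>\<Omega>. Q x > 0 \<and> f x < P x}|lebesgue.
         right_deriv \<Phi> \<bar>f x - P x\<bar> * \<bar>Q x\<bar>)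
      \<le> right_deriv \<Phi> 0 * (LINT x:{x\<in>\<Omega>. f x = P x}|lebesgue. \<bar>Q x\<bar>)"
    (is "_ \<longleftrightarrow> ?cond") if Q: "Q \<in> S" for Q
  proof -
    let ?h = "\<lambda>x t. \<Phi> \<bar>(f x - P x) - t * Q x\<bar>"
    let ?k = "\<lambda>x. phi_direction \<Phi> (f x - P x) (Q x)"
    obtain C D where CD: "\<And>x. \<bar>P x\<bar> \<le> C" "\<And>x. \<bar>Q x\<bar> \<le> D"
      using bdd[OF \<open>P \<in> S\<close>] bdd[OF Q] by auto
    have h_conv: "convex_on UNIV (?h x)" for x
      using convex_on_along_line[OF class_Psi_convex_abs[OF assms(1)], of "f x - P x" "- Q x"]
      by simp
    have h_int: "integrable ?M (\<lambda>x. ?h x t)" for t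
    proof -
      have "integrable ?M (\<lambda>x. \<Phi> \<bar>f x - (P x + t * Q x)\<bar>)"
      proof (rule integrable_phi_translate[OF assms(1,2) fin f])
        show "(\<lambda>x. P x + t * Q x) \<in> borel_measurable ?M"
          using meas[OF \<open>P \<in> S\<close>] meas[OF Q] by simp
        show "\<bar>P x + t * Q x\<bar> \<le> C + \<bar>t\<bar> * D" for x
          using CD[of x] abs_triangle_ineq[of "P x" "t * Q x"] mult_left_mono[of "\<bar>Q x\<bar>" D "\<bar>t\<bar>"]
          by (simp add: abs_mult)
      qed
      then show ?thesis by (simp add: algebra_simps)
    qed
    have h_der: "(?h x has_real_derivative ?k x) (at_right 0)" for x
      by (rule has_right_derivative_phi_direction[OF assms(1)])
    have k_int: "integrable ?M ?k"
      by (rule integrable_right_derivative[OF h_conv h_int h_der])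
    have "(\<forall>t>0. ?I P \<le> ?I (\<lambda>x. P x + t * Q x)) \<longleftrightarrow>
        (\<forall>t>0. (LINT x|?M. ?h x 0) \<le> (LINT x|?M. ?h x t))"
      by (simp add: algebra_simps)
    also have "\<dots> \<longleftrightarrow> 0 \<le> (LINT x|?M. ?k x)"
      by (rule integral_convex_minimal_on_ray_iff[OF h_conv h_int h_der])
    also have "\<dots> \<longleftrightarrow> ?cond"
    proof -
      have "{x\<in>\<Omega>. 0 < (f x - P x) * Q x} =
          {x\<in>\<Omega>. Q x > 0 \<and> f x > P x} \<union> {x\<in>\<Omega>. Q x < 0 \<and> f x < P x}"
        "{x\<in>\<Omega>. (f x - P x) * Q x < 0} =
          {x\<in>\<Omega>. Q x < 0 \<and> f x > P x} \<union> {x\<in>\<Omega>. Q x > 0 \<and> f x < P x}"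
        "{x\<in>\<Omega>. f x - P x = 0} = {x\<in>\<Omega>. f x = P x}"
        by (auto simp: zero_less_mult_iff mult_less_0_iff)
      moreover have "(\<lambda>x. f x - P x) \<in> borel_measurable ?M"
        using f(1) meas[OF \<open>P \<in> S\<close>] by simp
      note integral_phi_direction[OF assms(4) this meas[OF Q] k_int]
      ultimately show ?thesis by (simp only:) linarith
    qed
    finally show ?thesis .
  qed
  have "P \<in> best_approx \<Phi> \<Omega> f S \<longleftrightarrow> (\<forall>Q\<in>S. \<forall>t>0. ?I P \<le> ?I (\<lambda>x. P x + t * Q x))"
    unfolding best_approx_iff_minimal[OF assms(1) \<open>P \<in> S\<close>]
    by (rule minimal_on_subspace_iff_on_rays[OF assms(8) \<open>P \<in> S\<close>])
  with ray show ?thesis by simp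
qed

end
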